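(* Let $5 \le p \le q$, and suppose the complete tripartite graph $K(3,p,q)$ has a strong orientation with diameter two. Then $q \le \binom{p+1}{\lfloor \frac{p+1}{2} \rfloor} - 1$.
   Context: $K(3,p,q)$ is the complete tripartite graph with parts of sizes $3$, $p$, $q$. A strong orientation is an orientation of all edges making the digraph strongly connected; its diameter is the maximum, over ordered pairs of vertices $(u,v)$, of the length of a shortest directed path from $u$ to $v$. *)

theory Defs
  imports "Graph_Theory.Graph_Theory"
begin

text \<open>
  As in \<^theory>\<open>Graph_Theory.Kuratowski\<close>, an undirected simple graph is represented by a symmetric
  digraph (\<^const>\<open>graph\<close>): each edge is a pair of opposite arcs. The predicate below holds of every
  graph isomorphic to the complete tripartite graph with parts of sizes \<open>l\<close>, \<open>m\<close>, \<open>n\<close>.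
\<close>

definition complete_tripartite_digraph :: "nat \<Rightarrow> nat \<Rightarrow> nat \<Rightarrow> ('a, 'b) pre_digraph \<Rightarrow> bool" where
  "complete_tripartite_digraph l m n G \<equiv> graph G \<and>
    (\<exists>U V W. verts G = U \<union> V \<union> W \<and> U \<inter> V = {} \<and> U \<inter> W = {} \<and> V \<inter> W = {}
      \<and> card U = l \<and> card V = m \<and> card W = n
      \<and> arcs_ends G = U \<times> V \<union> V \<times> U \<union> U \<times> W \<union> W \<times> U \<union> V \<times> W \<union> W \<times> V)"

text \<open>
  \<open>D\<close> orients every edge of the graph \<open>G\<close> in exactly one of its two directions. The arc types of
  \<open>D\<close> and \<open>G\<close> are unrelated; only the ends of arcs matter.
\<close>

definition orientation :: "('a, 'c) pre_digraph \<Rightarrow> ('a, 'b) pre_digraph \<Rightarrow> bool" where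
  "orientation D G \<equiv> digraph D \<and> verts D = verts G
    \<and> arcs_ends D \<union> (arcs_ends D)\<inverse> = arcs_ends G
    \<and> arcs_ends D \<inter> (arcs_ends D)\<inverse> = {}"

definition strong_orientation :: "('a, 'c) pre_digraph \<Rightarrow> ('a, 'b) pre_digraph \<Rightarrow> bool" where
  "strong_orientation D G \<equiv> orientation D G \<and> strongly_connected D"

text \<open>
  With unit weights, \<^const>\<open>wf_digraph.\<mu>\<close> is the length of a shortest directed walk (equivalently,
  path), and \<open>\<infinity>\<close> if there is none.
\<close>

definition digraph_dist :: "('a, 'b) pre_digraph \<Rightarrow> 'a \<Rightarrow> 'a \<Rightarrow> ereal" where
  "digraph_dist D u v \<equiv> wf_digraph.\<mu> D (\<lambda>_. 1) u v"

definition digraph_diameter :: "('a, 'b) pre_digraph \<Rightarrow> ereal" where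
  "digraph_diameter D \<equiv> SUP (u, v) \<in> verts D \<times> verts D. digraph_dist D u v"

end

theory Submission
  imports Defs "HOL-Combinatorics.Multiset_Permutations"
begin

text \<open>
  Each vertex \<open>w\<close> of the part of size \<open>q\<close> is encoded by its out-neighbourhood \<open>(A, S)\<close>, with \<open>A\<close> inside
  the part \<open>V\<close> of size \<open>p\<close> and \<open>S\<close> inside the part \<open>U\<close> of size three. Diameter two makes these
  pairs an antichain and yields local conditions relating \<open>(A, S)\<close> to the sets \<open>N u \<subseteq> V\<close> of
  out-neighbours of the \<open>u \<in> U\<close>. Sort \<open>V\<close> into eight cells by type, the set of \<open>u\<close> with \<open>v \<in> N u\<close>. For fixed \<open>S\<close>,
  the conditions fix \<open>A\<close> outside certain cells, so Sperner's theorem bounds the number of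
  such \<open>A\<close> by a central binomial coefficient of the number of remaining vertices. Summed over the
  eight sets \<open>S\<close>, these bounds suffice unless some \<open>N a = V\<close> and some \<open>N c = {}\<close>. In that case
  every \<open>S\<close> contains \<open>a\<close> but not \<open>c\<close>, so the pairs form an antichain of subsets of \<open>V \<union> {b}\<close>; it avoids
  the maximal chain through \<open>N b\<close> and \<open>N b \<union> {b}\<close>, which makes Sperner's bound strict.
\<close>

section \<open>Inequalities between central binomial coefficients\<close>

definition midbinom :: "nat \<Rightarrow> nat" where "midbinom n = n choose (n div 2)"

lemma midbinom_mono: "m \<le> n \<Longrightarrow> midbinom m \<le> midbinom n"
proof (induction n)
  case (Suc n)
  have "midbinom n \<le> midbinom (Suc n)"
  proof -
    have "n choose (n div 2) \<le> Suc n choose (n div 2)" by (rule binomial_right_mono) simp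
    also have "\<dots> \<le> Suc n choose (Suc n div 2)" by (rule binomial_maximum)
    finally show ?thesis by (simp add: midbinom_def)
  qed
  then show ?case using Suc by (cases "m = Suc n") auto
qed auto

text \<open>With \<open>p = n + 3\<close> these compare the target, row \<open>p + 1\<close>, with
  the rows that bound the fibers. Pascal's rule reduces everything to entries of row
  \<open>n\<close> near the middle; symmetry identifies mirror entries, and lower bounds on the rest
  supply the additive slack.\<close>

lemma midbinom_ineqs:
  assumes "2 \<le> n"
  shows "midbinom (n+4) \<ge> midbinom (n+3) + midbinom (n+2) + 3" "midbinom (n+4) \<ge> 3 * midbinom (n+2) + 2"
    "midbinom (n+4) \<ge> midbinom (n+3) + 2 * midbinom (n+1) + 2" "midbinom (n+4) \<ge> midbinom (n+3) + midbinom (n+2) + midbinom n + 2"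
    "midbinom (n+3) \<ge> 2 * midbinom (n+1) + 2" "midbinom (n+2) \<ge> midbinom (n+1) + 3" "midbinom (n+2) \<ge> 2 * midbinom n" "midbinom n \<ge> 2"
proof -
  \<comment> \<open>Restricting Pascal's rule to rows \<open>n\<close> to \<open>n + 3\<close> stops the rewriting at row \<open>n\<close>, where everything is
    linear in a few entries around the middle.\<close>
  note pascal = binomial_Suc_Suc[of n] binomial_Suc_Suc[of "Suc n"] binomial_Suc_Suc[of "Suc (Suc n)"]
    binomial_Suc_Suc[of "Suc (Suc (Suc n))"]
  have "midbinom (n+4) \<ge> midbinom (n+3) + midbinom (n+2) + 3 \<and> midbinom (n+4) \<ge> 3 * midbinom (n+2) + 2 \<and>
    midbinom (n+4) \<ge> midbinom (n+3) + 2 * midbinom (n+1) + 2 \<and> midbinom (n+4) \<ge> midbinom (n+3) + midbinom (n+2) + midbinom n + 2 \<and>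
    midbinom (n+3) \<ge> 2 * midbinom (n+1) + 2 \<and> midbinom (n+2) \<ge> midbinom (n+1) + 3 \<and> midbinom (n+2) \<ge> 2 * midbinom n \<and> midbinom n \<ge> 2"
  proof (cases "even n")
    case True
    then obtain m where "n = 2 * m" by (rule evenE)
    with assms have "n = 2 * Suc (m - 1)" by simp
    then obtain k where k: "n = 2 * Suc k" by blast
    have d: "(2 * Suc k) div 2 = Suc k" "(2 * Suc k + 1) div 2 = Suc k" "(2 * Suc k + 2) div 2 = Suc (Suc k)"
      "(2 * Suc k + 3) div 2 = Suc (Suc k)" "(2 * Suc k + 4) div 2 = Suc (Suc (Suc k))" by auto
    have s1: "n choose Suc (Suc k) = n choose k" using k by (subst binomial_symmetric) auto
    \<comment> \<open>For \<open>k = 0\<close> truncated subtraction would turn the mirror position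
      \<open>k - 1\<close> into 0, although the entry vanishes, hence the case distinction.\<close>
    have s2: "n choose Suc (Suc (Suc k)) = (if k = 0 then 0 else n choose (k - 1))"
    proof (cases k)
      case (Suc j)
      then show ?thesis using k by (subst binomial_symmetric) auto
    qed (use k in simp)
    have c1: "n choose k \<ge> 1" using k by (simp add: Suc_le_eq)
    have c0: "n choose Suc k \<ge> 2"
    proof -
      have "n choose Suc k = (n - 1 choose Suc k) + (n - 1 choose k)" using k by simp
      moreover have "n - 1 choose Suc k \<ge> 1" "n - 1 choose k \<ge> 1" using k by (simp_all add: Suc_le_eq)
      ultimately show ?thesis by linarith
    qed
    have e: "midbinom n = n choose Suc k" "midbinom (n+1) = Suc n choose Suc k" "midbinom (n+2) = Suc (Suc n) choose Suc (Suc k)"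
      "midbinom (n+3) = Suc (Suc (Suc n)) choose Suc (Suc k)" "midbinom (n+4) = Suc (Suc (Suc (Suc n))) choose Suc (Suc (Suc k))"
      unfolding midbinom_def by (simp_all only: k d) (simp_all add: eval_nat_numeral)
    show ?thesis unfolding e using s1 s2 c1 c0
      by (cases k) (simp_all del: binomial_Suc_Suc add: pascal)
  next
    case False
    then obtain m where "n = 2 * m + 1" by (rule oddE)
    with assms have "n = 2 * Suc (m - 1) + 1" by simp
    then obtain k where k: "n = 2 * Suc k + 1" by blast
    have d: "(2 * Suc k + 1) div 2 = Suc k" "(2 * Suc k + 1 + 1) div 2 = Suc (Suc k)" "(2 * Suc k + 1 + 2) div 2 = Suc (Suc k)"
      "(2 * Suc k + 1 + 3) div 2 = Suc (Suc (Suc k))" "(2 * Suc k + 1 + 4) div 2 = Suc (Suc (Suc k))" by auto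
    have s1: "n choose Suc (Suc k) = n choose Suc k" using k by (subst binomial_symmetric) auto
    have s2: "n choose Suc (Suc (Suc k)) = n choose k" using k by (subst binomial_symmetric) auto
    have c1: "n choose k \<ge> 1" using k by (simp add: Suc_le_eq)
    have c0: "n choose Suc k \<ge> 2"
    proof -
      have "n choose Suc k = (n - 1 choose Suc k) + (n - 1 choose k)" using k by simp
      moreover have "n - 1 choose Suc k \<ge> 1" "n - 1 choose k \<ge> 1" using k by (simp_all add: Suc_le_eq)
      ultimately show ?thesis by linarith
    qed
    have e: "midbinom n = n choose Suc k" "midbinom (n+1) = Suc n choose Suc (Suc k)" "midbinom (n+2) = Suc (Suc n) choose Suc (Suc k)"
      "midbinom (n+3) = Suc (Suc (Suc n)) choose Suc (Suc (Suc k))" "midbinom (n+4) = Suc (Suc (Suc (Suc n))) choose Suc (Suc (Suc k))"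
      unfolding midbinom_def by (simp_all only: k d) (simp_all add: eval_nat_numeral)
    show ?thesis unfolding e using s1 s2 c1 c0
      by (cases k) (simp_all del: binomial_Suc_Suc add: pascal)
  qed
  then show "midbinom (n+4) \<ge> midbinom (n+3) + midbinom (n+2) + 3" "midbinom (n+4) \<ge> 3 * midbinom (n+2) + 2"
    "midbinom (n+4) \<ge> midbinom (n+3) + 2 * midbinom (n+1) + 2" "midbinom (n+4) \<ge> midbinom (n+3) + midbinom (n+2) + midbinom n + 2"
    "midbinom (n+3) \<ge> 2 * midbinom (n+1) + 2" "midbinom (n+2) \<ge> midbinom (n+1) + 3" "midbinom (n+2) \<ge> 2 * midbinom n" "midbinom n \<ge> 2" by auto
qed

section \<open>Arithmetic of the eight cell sizes\<close>

text \<open>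
  Here \<open>x\<close>, \<open>y\<close>, \<open>z\<close>, \<open>X\<close>, \<open>Y\<close>, \<open>Z\<close>, \<open>e\<close>, \<open>t\<close> are the sizes of the cells of types \<open>{a}\<close>, \<open>{b}\<close>, \<open>{c}\<close>,
  \<open>{b, c}\<close>, \<open>{a, c}\<close>, \<open>{a, b}\<close>, \<open>{}\<close>, \<open>{a, b, c}\<close>, and \<open>g0\<close>, \<open>g1\<close>, \<open>g2\<close>, \<open>g3\<close>, \<open>g12\<close>, \<open>g13\<close>, \<open>g23\<close>, \<open>g123\<close> the
  numbers of pairs \<open>(A, S)\<close> with \<open>S\<close> equal to \<open>{}\<close>, \<open>{a}\<close>, \<open>{b}\<close>, \<open>{c}\<close>, \<open>{a, b}\<close>, \<open>{a, c}\<close>, \<open>{b, c}\<close>, \<open>{a, b, c}\<close>.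
  All that matters about \<open>\<mu>\<close> is how far its argument lies below \<open>p\<close>, which leaves a
  finite linear problem.
\<close>

lemma profile_bound_int:
  fixes p x y z X Y Z e t g0 g1 g2 g3 g12 g13 g23 g123 N m0 m1 m2 m3 :: int and \<mu> :: "int \<Rightarrow> int"
  assumes "5 \<le> p" and "x + y + z + X + Y + Z + e + t = p"
    and "0 \<le> x" "0 \<le> y" "0 \<le> z" "0 \<le> X" "0 \<le> Y" "0 \<le> Z" "0 \<le> e" "0 \<le> t"
    and "m0 + m1 + 3 \<le> N" "3 * m1 + 2 \<le> N" "m0 + 2 * m2 + 2 \<le> N" "m0 + m1 + m3 + 2 \<le> N"
      "2 * m2 + 2 \<le> m0" "m2 + 3 \<le> m1" "2 * m3 \<le> m1" "2 \<le> m3" "m3 \<le> m2"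
    and \<mu>: "\<And>k. k \<le> p \<Longrightarrow> \<mu> k \<le> m0" "\<And>k. k + 1 \<le> p \<Longrightarrow> \<mu> k \<le> m1"
      "\<And>k. k + 2 \<le> p \<Longrightarrow> \<mu> k \<le> m2" "\<And>k. k + 3 \<le> p \<Longrightarrow> \<mu> k \<le> m3" "\<And>k. k \<le> 1 \<Longrightarrow> \<mu> k = 1"
    and "g0 \<le> 1" "g1 \<le> \<mu> (x + Y + Z)" "g2 \<le> \<mu> (y + X + Z)" "g3 \<le> \<mu> (z + X + Y)"
      "g12 \<le> \<mu> (x + y + Z)" "g13 \<le> \<mu> (x + z + Y)" "g23 \<le> \<mu> (y + z + X)" "g123 \<le> 1"
    and "X > 0 \<longrightarrow> g1 = 0" "Y > 0 \<longrightarrow> g2 = 0" "Z > 0 \<longrightarrow> g3 = 0" "x > 0 \<longrightarrow> g23 = 0"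
      "y > 0 \<longrightarrow> g13 = 0" "z > 0 \<longrightarrow> g12 = 0" "t > 0 \<longrightarrow> g0 = 0" "e > 0 \<longrightarrow> g123 = 0"
    and "x + Z \<noteq> p" "x + Y \<noteq> p" "y + Z \<noteq> p" "y + X \<noteq> p" "z + X \<noteq> p" "z + Y \<noteq> p"
    and "x + Y + Z + t = p \<longrightarrow> g0 = 0 \<and> g2 = 0 \<and> g3 = 0 \<and> g23 = 0"
      "y + X + Z + t = p \<longrightarrow> g0 = 0 \<and> g1 = 0 \<and> g3 = 0 \<and> g13 = 0"
      "z + X + Y + t = p \<longrightarrow> g0 = 0 \<and> g1 = 0 \<and> g2 = 0 \<and> g12 = 0"
      "y + z + X + e = p \<longrightarrow> g1 = 0 \<and> g12 = 0 \<and> g13 = 0 \<and> g123 = 0"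
      "x + z + Y + e = p \<longrightarrow> g2 = 0 \<and> g12 = 0 \<and> g23 = 0 \<and> g123 = 0"
      "x + y + Z + e = p \<longrightarrow> g3 = 0 \<and> g13 = 0 \<and> g23 = 0 \<and> g123 = 0"
    and "x + Y + Z + t = 1 \<longrightarrow> g12 \<le> \<mu> y \<and> g13 \<le> \<mu> z"
      "y + X + Z + t = 1 \<longrightarrow> g12 \<le> \<mu> x \<and> g23 \<le> \<mu> z"
      "z + X + Y + t = 1 \<longrightarrow> g13 \<le> \<mu> x \<and> g23 \<le> \<mu> y"
      "y + z + X + e = 1 \<longrightarrow> g2 \<le> \<mu> Z \<and> g3 \<le> \<mu> Y"
      "x + z + Y + e = 1 \<longrightarrow> g1 \<le> \<mu> Z \<and> g3 \<le> \<mu> X"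
      "x + y + Z + e = 1 \<longrightarrow> g1 \<le> \<mu> Y \<and> g2 \<le> \<mu> X"
  shows "g0 + g1 + g2 + g3 + g12 + g13 + g23 + g123 < N"
proof -
  have \<mu>': "(k \<le> p \<longrightarrow> \<mu> k \<le> m0) \<and> (k + 1 \<le> p \<longrightarrow> \<mu> k \<le> m1) \<and> (k + 2 \<le> p \<longrightarrow> \<mu> k \<le> m2) \<and>
    (k + 3 \<le> p \<longrightarrow> \<mu> k \<le> m3) \<and> (k \<le> 1 \<longrightarrow> \<mu> k = 1)" for k
    using \<mu> by blast
  \<comment> \<open>The quantified hypotheses on \<open>\<mu>\<close> are replaced by their
    instances at the twelve arguments that occur.\<close>
  show ?thesis
    using assms(1-19,25-) \<mu>'[of "x + Y + Z"] \<mu>'[of "y + X + Z"] \<mu>'[of "z + X + Y"]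
      \<mu>'[of "x + y + Z"] \<mu>'[of "x + z + Y"] \<mu>'[of "y + z + X"]
      \<mu>'[of x] \<mu>'[of y] \<mu>'[of z] \<mu>'[of X] \<mu>'[of Y] \<mu>'[of Z]
    by (smt (z3))
qed

text \<open>Transfers the integer version, with \<open>\<mu> k = midbinom (nat k)\<close>. Writing
  \<open>p = n + 3\<close> makes \<open>N\<close>, \<open>m0\<close>, \<open>m1\<close>,
  \<open>m2\<close>, \<open>m3\<close> the central coefficients of rows \<open>n + 4\<close> down to
  \<open>n\<close>, and \<open>5 \<le> p\<close> gives the bound \<open>2 \<le> n\<close> that
  \<open>midbinom_ineqs\<close> asks for.\<close>

lemma profile_bound:
  fixes p x y z X Y Z e t g0 g1 g2 g3 g12 g13 g23 g123 :: nat
  assumes p: "5 \<le> p" and "x + y + z + X + Y + Z + e + t = p"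
    and "g0 \<le> 1" "g1 \<le> midbinom (x + Y + Z)" "g2 \<le> midbinom (y + X + Z)" "g3 \<le> midbinom (z + X + Y)"
      "g12 \<le> midbinom (x + y + Z)" "g13 \<le> midbinom (x + z + Y)" "g23 \<le> midbinom (y + z + X)" "g123 \<le> 1"
    and "X > 0 \<longrightarrow> g1 = 0" "Y > 0 \<longrightarrow> g2 = 0" "Z > 0 \<longrightarrow> g3 = 0" "x > 0 \<longrightarrow> g23 = 0"
      "y > 0 \<longrightarrow> g13 = 0" "z > 0 \<longrightarrow> g12 = 0" "t > 0 \<longrightarrow> g0 = 0" "e > 0 \<longrightarrow> g123 = 0"
    and "x + Z \<noteq> p" "x + Y \<noteq> p" "y + Z \<noteq> p" "y + X \<noteq> p" "z + X \<noteq> p" "z + Y \<noteq> p"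
    and "x + Y + Z + t = p \<longrightarrow> g0 = 0 \<and> g2 = 0 \<and> g3 = 0 \<and> g23 = 0"
      "y + X + Z + t = p \<longrightarrow> g0 = 0 \<and> g1 = 0 \<and> g3 = 0 \<and> g13 = 0"
      "z + X + Y + t = p \<longrightarrow> g0 = 0 \<and> g1 = 0 \<and> g2 = 0 \<and> g12 = 0"
      "y + z + X + e = p \<longrightarrow> g1 = 0 \<and> g12 = 0 \<and> g13 = 0 \<and> g123 = 0"
      "x + z + Y + e = p \<longrightarrow> g2 = 0 \<and> g12 = 0 \<and> g23 = 0 \<and> g123 = 0"
      "x + y + Z + e = p \<longrightarrow> g3 = 0 \<and> g13 = 0 \<and> g23 = 0 \<and> g123 = 0"
    and "x + Y + Z + t = 1 \<longrightarrow> g12 \<le> midbinom y \<and> g13 \<le> midbinom z"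
      "y + X + Z + t = 1 \<longrightarrow> g12 \<le> midbinom x \<and> g23 \<le> midbinom z"
      "z + X + Y + t = 1 \<longrightarrow> g13 \<le> midbinom x \<and> g23 \<le> midbinom y"
      "y + z + X + e = 1 \<longrightarrow> g2 \<le> midbinom Z \<and> g3 \<le> midbinom Y"
      "x + z + Y + e = 1 \<longrightarrow> g1 \<le> midbinom Z \<and> g3 \<le> midbinom X"
      "x + y + Z + e = 1 \<longrightarrow> g1 \<le> midbinom Y \<and> g2 \<le> midbinom X"
  shows "g0 + g1 + g2 + g3 + g12 + g13 + g23 + g123 < midbinom (p + 1)"
proof -
  obtain n where n: "p = n + 3" "2 \<le> n" using p that[of "p - 3"] by auto
  have midbinom_le: "int (midbinom (nat k)) \<le> int (midbinom m)" if "k \<le> int m" for k m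
    using that by (intro of_nat_mono midbinom_mono) simp
  have midbinom_1: "int (midbinom (nat k)) = 1" if "k \<le> 1" for k
  proof -
    have "nat k = 0 \<or> nat k = 1" using that by linarith
    then show ?thesis by (auto simp: midbinom_def)
  qed
  have num: "int (midbinom (n+3)) + int (midbinom (n+2)) + 3 \<le> int (midbinom (n+4))" "3 * int (midbinom (n+2)) + 2 \<le> int (midbinom (n+4))"
    "int (midbinom (n+3)) + 2 * int (midbinom (n+1)) + 2 \<le> int (midbinom (n+4))"
    "int (midbinom (n+3)) + int (midbinom (n+2)) + int (midbinom n) + 2 \<le> int (midbinom (n+4))"
    "2 * int (midbinom (n+1)) + 2 \<le> int (midbinom (n+3))" "int (midbinom (n+1)) + 3 \<le> int (midbinom (n+2))"
    "2 * int (midbinom n) \<le> int (midbinom (n+2))" "2 \<le> int (midbinom n)" "int (midbinom n) \<le> int (midbinom (n+1))"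
    using midbinom_ineqs[OF n(2)] midbinom_mono[of n "n + 1"] by linarith+
  have "int g0 + int g1 + int g2 + int g3 + int g12 + int g13 + int g23 + int g123 < int (midbinom (n + 4))"
    by (rule profile_bound_int[where p = "int p" and x = "int x" and y = "int y" and z = "int z"
          and X = "int X" and Y = "int Y" and Z = "int Z" and e = "int e" and t = "int t"
          and \<mu> = "\<lambda>k. int (midbinom (nat k))"])
        (fact num | (rule midbinom_le; simp add: n(1); linarith) | (rule midbinom_1; assumption) | (simp flip: of_nat_add; fail)
          | (simp flip: of_nat_add, rule assms[unfolded One_nat_def]))+
  then show ?thesis using n by (simp add: eval_nat_numeral flip: of_nat_add)
qed

section \<open>Sperner's theorem by counting permutations\<close>

text \<open>A permutation encodes the maximal chain of its prefix sets. Chains through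
  \<open>A\<close> arise by appending an ordering of \<open>V - A\<close> to one of
  \<open>A\<close>; this is injective because all first pieces have the same length.\<close>

lemma card_permutations_with_prefix_set:
  assumes "finite V" "A \<subseteq> V"
  shows "fact (card A) * fact (card V - card A)
    \<le> card {xs \<in> permutations_of_set V. set (take (card A) xs) = A}"
proof -
  let ?P = "permutations_of_set A \<times> permutations_of_set (V - A)"
  have fA: "finite A" using assms finite_subset by blast
  have inj: "inj_on (\<lambda>(ys, zs). ys @ zs) ?P"
    proof (rule inj_onI)
    fix p q assume pq: "p \<in> ?P" "q \<in> ?P" "(\<lambda>(ys, zs). ys @ zs) p = (\<lambda>(ys, zs). ys @ zs) q"
    then have "length (fst p) = length (fst q)"
      by (auto simp: length_finite_permutations_of_set)
    then show "p = q" using pq by (auto simp: prod_eq_iff split_beta)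
  qed
  have "fact (card A) * fact (card V - card A) = card ?P"
    using assms fA by (simp add: card_cartesian_product card_Diff_subset)
  also have "\<dots> = card ((\<lambda>(ys, zs). ys @ zs) ` ?P)"
    using inj by (simp add: card_image)
  also have "\<dots> \<le> card {xs \<in> permutations_of_set V. set (take (card A) xs) = A}"
  proof (rule card_mono)
    show "(\<lambda>(ys, zs). ys @ zs) ` ?P \<subseteq> {xs \<in> permutations_of_set V. set (take (card A) xs) = A}"
      using assms(2) by (auto simp: permutations_of_set_def distinct_card)
  qed simp
  finally show ?thesis .
qed

text \<open>Prefix sets of one list are nested, so each chain meets \<open>F\<close> at most once,
  while each member of \<open>F\<close> lies on at least
  \<open>fact (card V) / midbinom (card V)\<close> chains. Keeping the number of chains that meet
  \<open>F\<close> on the right lets a missed chain yield strictness later.\<close>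

lemma antichain_lym:
  assumes V: "finite V" and F: "F \<subseteq> Pow V" and anti: "pairwise (\<lambda>A B. \<not> A \<subseteq> B) F"
  shows "card F * fact (card V) \<le> midbinom (card V) *
    card {xs \<in> permutations_of_set V. \<exists>A\<in>F. set (take (card A) xs) = A}"
proof -
  define Q where "Q A = {xs \<in> permutations_of_set V. set (take (card A) xs) = A}" for A
  have fF: "finite F" using V F finite_subset by blast
  have disj: "Q A \<inter> Q B = {}" if "A \<in> F" "B \<in> F" "A \<noteq> B" for A B
  proof (rule ccontr)
    assume "Q A \<inter> Q B \<noteq> {}"
    then obtain xs where "set (take (card A) xs) = A" "set (take (card B) xs) = B"
      by (auto simp: Q_def)
    then have "A \<subseteq> B \<or> B \<subseteq> A"
      by (metis nle_le set_take_subset_set_take)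
    then show False using anti that by (auto simp: pairwise_def)
  qed
  have "card F * fact (card V) = (\<Sum>A\<in>F. fact (card V))" by simp
  also have "\<dots> \<le> (\<Sum>A\<in>F. midbinom (card V) * card (Q A))"
  proof (rule sum_mono)
    fix A assume "A \<in> F"
    then have A: "A \<subseteq> V" using F by auto
    then have "fact (card V) = fact (card A) * fact (card V - card A) * (card V choose card A)"
      using V by (simp add: binomial_fact_lemma card_mono)
    also have "\<dots> \<le> card (Q A) * midbinom (card V)"
      unfolding Q_def midbinom_def
      by (intro mult_mono card_permutations_with_prefix_set V A binomial_maximum) auto
    finally show "fact (card V) \<le> midbinom (card V) * card (Q A)" by (simp add: mult.commute)
  qed
  also have "\<dots> = midbinom (card V) * (\<Sum>A\<in>F. card (Q A))" by (simp add: sum_distrib_left)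
  also have "(\<Sum>A\<in>F. card (Q A)) = card (\<Union>A\<in>F. Q A)"
    using fF disj by (subst card_UN_disjoint) (auto simp: Q_def)
  also have "(\<Union>A\<in>F. Q A) = {xs \<in> permutations_of_set V. \<exists>A\<in>F. set (take (card A) xs) = A}"
    by (auto simp: Q_def)
  finally show ?thesis .
qed

lemma sperner:
  assumes V: "finite V" and F: "F \<subseteq> Pow V" and anti: "pairwise (\<lambda>A B. \<not> A \<subseteq> B) F"
  shows "card F \<le> midbinom (card V)"
proof -
  have "card {xs \<in> permutations_of_set V. \<exists>A\<in>F. set (take (card A) xs) = A} \<le> card (permutations_of_set V)"
    by (intro card_mono finite_permutations_of_set) blast
  then have "midbinom (card V) * card {xs \<in> permutations_of_set V. \<exists>A\<in>F. set (take (card A) xs) = A}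
      \<le> midbinom (card V) * fact (card V)"
    using V by simp
  then have "card F * fact (card V) \<le> midbinom (card V) * fact (card V)"
    using antichain_lym[OF assms] by linarith
  then show ?thesis by simp
qed

text \<open>The missed chain \<open>xs\<close> makes the count in \<open>antichain_lym\<close>
  strictly smaller than \<open>fact (card V)\<close>.\<close>

lemma sperner_strict:
  assumes V: "finite V" and F: "F \<subseteq> Pow V" and anti: "pairwise (\<lambda>A B. \<not> A \<subseteq> B) F"
    and xs: "xs \<in> permutations_of_set V" and missed: "\<And>k. set (take k xs) \<notin> F"
  shows "card F < midbinom (card V)"
proof -
  have "{xs \<in> permutations_of_set V. \<exists>A\<in>F. set (take (card A) xs) = A} \<subset> permutations_of_set V"
  proof -
    have "xs \<notin> {xs \<in> permutations_of_set V. \<exists>A\<in>F. set (take (card A) xs) = A}"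
    proof
      assume "xs \<in> {xs \<in> permutations_of_set V. \<exists>A\<in>F. set (take (card A) xs) = A}"
      then obtain A where "A \<in> F" "set (take (card A) xs) = A" by blast
      then show False using missed[of "card A"] by simp
    qed
    then show ?thesis using xs by blast
  qed
  then have "card {xs \<in> permutations_of_set V. \<exists>A\<in>F. set (take (card A) xs) = A} < card (permutations_of_set V)"
    by (intro psubset_card_mono finite_permutations_of_set)
  then have "midbinom (card V) * card {xs \<in> permutations_of_set V. \<exists>A\<in>F. set (take (card A) xs) = A}
      < midbinom (card V) * fact (card V)"
    using V by (simp add: midbinom_def)
  then have "card F * fact (card V) < midbinom (card V) * fact (card V)"
    using antichain_lym[OF V F anti] by linarith
  then show ?thesis by simp
qed

section \<open>Fibers and cells of a neighborhood family\<close>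

lemma sum_Pow_insert:
  assumes "finite B" "a \<notin> B"
  shows "sum f (Pow (insert a B)) = sum f (Pow B) + (\<Sum>T\<in>Pow B. f (insert a T))"
proof -
  have "inj_on (insert a) (Pow B)" using assms(2) by (auto simp: inj_on_def insert_eq_iff)
  moreover have "Pow B \<inter> insert a ` Pow B = {}" using assms(2) by auto
  ultimately show ?thesis
    using assms(1) by (simp add: Pow_insert sum.union_disjoint sum.reindex)
qed

text \<open>The conditions record two-step paths for a vertex \<open>w\<close> encoded as
  \<open>(A, S)\<close>: between two such vertices (\<open>F_antichain\<close>), from
  \<open>u\<close> to \<open>w\<close> and back (\<open>N_not_below\<close>,
  \<open>N_not_above\<close>), and from \<open>v\<close> to \<open>w\<close> and back
  (\<open>mem_witness\<close>, \<open>nonmem_witness\<close>).\<close>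

locale neighborhood_family =
  fixes V U :: "'a set" and N :: "'a \<Rightarrow> 'a set" and F :: "('a set \<times> 'a set) set"
  assumes finite_V: "finite V" and finite_U: "finite U" and disjoint: "V \<inter> U = {}"
    and N_subset: "N u \<subseteq> V"
    and F_subset: "(A, S) \<in> F \<Longrightarrow> A \<subseteq> V \<and> S \<subseteq> U"
    and F_antichain: "(A, S) \<in> F \<Longrightarrow> (B, T) \<in> F \<Longrightarrow> A \<subseteq> B \<Longrightarrow> S \<subseteq> T \<Longrightarrow> A = B \<and> S = T"
    and N_not_below: "(A, S) \<in> F \<Longrightarrow> u \<in> S \<Longrightarrow> \<not> N u \<subseteq> A"
    and N_not_above: "(A, S) \<in> F \<Longrightarrow> u \<in> U - S \<Longrightarrow> \<not> A \<subseteq> N u"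
    and mem_witness: "(A, S) \<in> F \<Longrightarrow> v \<in> A \<Longrightarrow> \<exists>u\<in>U - S. v \<notin> N u"
    and nonmem_witness: "(A, S) \<in> F \<Longrightarrow> v \<in> V - A \<Longrightarrow> \<exists>u\<in>S. v \<in> N u"
begin

definition ty :: "'a \<Rightarrow> 'a set" where "ty v = {u \<in> U. v \<in> N u}"
definition cell :: "'a set \<Rightarrow> 'a set" where "cell T = {v \<in> V. ty v = T}"
definition fiber :: "'a set \<Rightarrow> 'a set set" where "fiber S = {A. (A, S) \<in> F}"

lemma card_by_type:
  "card {v \<in> V. P (ty v)} = (\<Sum>T\<in>Pow U. if P T then card (cell T) else 0)"
proof -
  have "{v \<in> V. P (ty v)} = (\<Union>T\<in>{T \<in> Pow U. P T}. cell T)"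
    by (auto simp: cell_def ty_def)
  then have "card {v \<in> V. P (ty v)} = (\<Sum>T\<in>{T \<in> Pow U. P T}. card (cell T))"
    using finite_V finite_U by (auto simp: cell_def intro!: card_UN_disjoint)
  then show ?thesis
    using finite_U sum.inter_filter[of "Pow U" "\<lambda>T. card (cell T)" P] by (simp del: Pow_iff)
qed

lemma card_F: "card F = (\<Sum>S\<in>Pow U. card (fiber S))"
proof -
  have "F = prod.swap ` (SIGMA S:Pow U. fiber S)"
    using F_subset by (force simp: fiber_def)
  moreover have "finite (fiber S)" for S
    by (rule finite_subset[of _ "Pow V"]) (use F_subset finite_V in \<open>auto simp: fiber_def\<close>)
  ultimately have "card F = card (SIGMA S:Pow U. fiber S)" "\<forall>S\<in>Pow U. finite (fiber S)"
    using card_image[of prod.swap "SIGMA S:Pow U. fiber S"] by auto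
  then show ?thesis using finite_U by (simp add: card_SigmaI)
qed

text \<open>Members of one fiber agree outside \<open>R\<close> and share \<open>S\<close>, so
  intersecting with \<open>R\<close> loses nothing and creates no inclusion; Sperner's theorem then
  applies inside \<open>R\<close>.\<close>

lemma card_fiber_le_if_fixed_outside:
  assumes R: "R \<subseteq> V" and fixed: "\<And>A v. A \<in> fiber S \<Longrightarrow> v \<in> V - R \<Longrightarrow> v \<in> A \<longleftrightarrow> P v"
  shows "card (fiber S) \<le> midbinom (card R)"
proof -
  have le: "A \<subseteq> B" if "A \<in> fiber S" "B \<in> fiber S" "A \<inter> R \<subseteq> B" for A B
  proof
    fix v assume "v \<in> A"
    moreover have "v \<in> V" using \<open>v \<in> A\<close> that(1) F_subset by (auto simp: fiber_def)
    ultimately show "v \<in> B" using that fixed[of A v] fixed[of B v] by auto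
  qed
  then have anti: "A = B" if "A \<in> fiber S" "B \<in> fiber S" "A \<inter> R \<subseteq> B" for A B
    using F_antichain[of A S B S] le[OF that] that(1,2) by (simp add: fiber_def)
  have "inj_on (\<lambda>A. A \<inter> R) (fiber S)"
    by (rule inj_onI) (rule anti, auto)
  then have "card (fiber S) = card ((\<lambda>A. A \<inter> R) ` fiber S)"
    by (simp add: card_image)
  also have "\<dots> \<le> midbinom (card R)"
  proof (rule sperner)
    show "finite R" using R finite_V finite_subset by blast
    show "pairwise (\<lambda>A B. \<not> A \<subseteq> B) ((\<lambda>A. A \<inter> R) ` fiber S)"
      using anti by (auto simp: pairwise_def)
  qed auto
  finally show ?thesis .
qed

text \<open>A type disjoint from \<open>S\<close> leaves no candidate for
  \<open>nonmem_witness\<close>, and a type containing \<open>U - S\<close> leaves none for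
  \<open>mem_witness\<close>.\<close>

lemma fiber_mem_iff:
  assumes "A \<in> fiber S" "v \<in> V" "ty v \<inter> S = {} \<or> U - S \<subseteq> ty v"
  shows "v \<in> A \<longleftrightarrow> ty v \<inter> S = {}"
proof
  assume "v \<in> A"
  then have "\<not> U - S \<subseteq> ty v"
    using assms(1) mem_witness[of A S v] by (auto simp: fiber_def ty_def)
  then show "ty v \<inter> S = {}" using assms(3) by blast
next
  assume "ty v \<inter> S = {}"
  then show "v \<in> A"
    using assms(1,2) nonmem_witness[of A S v] F_subset[of A S] by (fastforce simp: fiber_def ty_def)
qed

lemma card_fiber_le:
  "card (fiber S) \<le> midbinom (card {v \<in> V. ty v \<inter> S \<noteq> {} \<and> \<not> U - S \<subseteq> ty v})"
  by (rule card_fiber_le_if_fixed_outside[where P = "\<lambda>v. ty v \<inter> S = {}"])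
    (use fiber_mem_iff in blast)+

text \<open>A vertex of type \<open>U - S\<close> has neither kind of witness, so it can lie neither
  in \<open>A\<close> nor outside.\<close>

lemma fiber_eq_empty_if_cell:
  assumes "S \<subseteq> U" "cell (U - S) \<noteq> {}"
  shows "fiber S = {}"
proof (rule ccontr)
  assume "fiber S \<noteq> {}"
  then obtain A where A: "(A, S) \<in> F" by (auto simp: fiber_def)
  obtain v where v: "v \<in> V" "ty v = U - S" using assms(2) by (auto simp: cell_def)
  then have "v \<in> A" using fiber_mem_iff[of A S v] A by (auto simp: fiber_def)
  then show False using mem_witness[OF A] v by (auto simp: ty_def)
qed

lemma fiber_eq_empty_if_full: "N u = V \<Longrightarrow> u \<in> U - S \<Longrightarrow> fiber S = {}"
  using N_not_above F_subset by (fastforce simp: fiber_def)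

lemma fiber_eq_empty_if_empty: "N u = {} \<Longrightarrow> u \<in> S \<Longrightarrow> fiber S = {}"
  using N_not_below by (fastforce simp: fiber_def)

text \<open>\<open>N_not_below\<close> excludes the only vertex of \<open>N u\<close> from
  \<open>A\<close>, so vertices whose type contains \<open>u\<close> are no longer free.\<close>

lemma card_fiber_le_if_singleton:
  assumes "card (N u) = 1" "u \<in> S" "u \<in> U"
  shows "card (fiber S) \<le> midbinom (card {v \<in> V. ty v \<inter> S \<noteq> {} \<and> \<not> U - S \<subseteq> ty v \<and> u \<notin> ty v})"
proof (rule card_fiber_le_if_fixed_outside[where P = "\<lambda>v. ty v \<inter> S = {}"])
  fix A v assume A: "A \<in> fiber S"
    and v: "v \<in> V - {v \<in> V. ty v \<inter> S \<noteq> {} \<and> \<not> U - S \<subseteq> ty v \<and> u \<notin> ty v}"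
  show "v \<in> A \<longleftrightarrow> ty v \<inter> S = {}"
  proof (cases "u \<in> ty v")
    case True
    then have "v \<in> N u" by (simp add: ty_def)
    then have "N u = {v}" using assms(1) by (auto simp: card_1_singleton_iff)
    then have "v \<notin> A" using N_not_below[of A S u] A assms(2) by (auto simp: fiber_def)
    then show ?thesis using True assms(2) by auto
  next
    case False
    then show ?thesis using v fiber_mem_iff[OF A] by blast
  qed
qed auto

text \<open>Dually, \<open>N_not_above\<close> forces the only vertex outside \<open>N u\<close>
  into \<open>A\<close>.\<close>

lemma card_fiber_le_if_co_singleton:
  assumes "card (V - N u) = 1" "u \<in> U - S"
  shows "card (fiber S) \<le> midbinom (card {v \<in> V. ty v \<inter> S \<noteq> {} \<and> \<not> U - S \<subseteq> ty v \<and> u \<in> ty v})"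
proof (rule card_fiber_le_if_fixed_outside[where P = "\<lambda>v. u \<notin> ty v \<or> ty v \<inter> S = {}"])
  fix A v assume A: "A \<in> fiber S"
    and v: "v \<in> V - {v \<in> V. ty v \<inter> S \<noteq> {} \<and> \<not> U - S \<subseteq> ty v \<and> u \<in> ty v}"
  show "v \<in> A \<longleftrightarrow> u \<notin> ty v \<or> ty v \<inter> S = {}"
  proof (cases "u \<in> ty v")
    case True
    then show ?thesis using v fiber_mem_iff[OF A] by blast
  next
    case False
    then have "v \<in> V - N u" using v assms(2) by (auto simp: ty_def)
    moreover obtain w where "V - N u = {w}" using assms(1) card_1_singletonE by blast
    ultimately have "V - N u = {v}" by (metis singletonD)
    then have "v \<in> A"
      using N_not_above[of A S u] A assms(2) F_subset[of A S] by (auto simp: fiber_def)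
    then show ?thesis using False by auto
  qed
qed auto

lemma card_F_less_if_full_and_empty:
  assumes U: "U = {a, b, c}" and neq: "a \<noteq> b" "a \<noteq> c" "b \<noteq> c" and "N a = V" "N c = {}"
  shows "card F < midbinom (card V + 1)"
proof -
  have S: "a \<in> S \<and> c \<notin> S \<and> S \<subseteq> U \<and> A \<subseteq> V" if "(A, S) \<in> F" for A S
    using that F_subset[of A S] N_not_below[of A S c] N_not_above[of A S a] assms by auto
  have b: "b \<notin> V" using disjoint U by auto
  \<comment> \<open>Since \<open>a\<close> is always in \<open>S\<close> and \<open>c\<close> never,
    only membership of \<open>b\<close> varies; as \<open>b\<close> is not in \<open>V\<close>, it
    can be stored in the same set as \<open>A\<close>.\<close>
  define f where "f = (\<lambda>(A, S). A \<union> (S \<inter> {b}))"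
  have order: "A \<subseteq> B \<and> S \<subseteq> T" if "(A, S) \<in> F" "(B, T) \<in> F" "f (A, S) \<subseteq> f (B, T)" for A B S T
    using S[OF that(1)] S[OF that(2)] that(3) b U neq by (auto simp: f_def)
  have anti: "A = B \<and> S = T" if "(A, S) \<in> F" "(B, T) \<in> F" "f (A, S) \<subseteq> f (B, T)" for A B S T
    using order[OF that] F_antichain[OF that(1,2)] by blast
  \<comment> \<open>In the chain of \<open>ys @ b # zs\<close> every prefix set either lies inside
    \<open>N b\<close>, where \<open>N_not_above\<close> rules it out, or contains
    \<open>N b\<close> and \<open>b\<close>, where \<open>N_not_below\<close> does.\<close>
  obtain ys where ys: "set ys = N b" "distinct ys"
    using finite_distinct_list[OF finite_subset[OF N_subset finite_V]] by blast
  obtain zs where zs: "set zs = V - N b" "distinct zs"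
    using finite_distinct_list[of "V - N b"] finite_V by auto
  have "inj_on f F"
    unfolding inj_on_def by (metis anti order_refl prod.collapse)
  then have "card F = card (f ` F)" by (simp add: card_image)
  also have "\<dots> < midbinom (card (insert b V))"
  proof (rule sperner_strict[where xs = "ys @ b # zs"])
    show "finite (insert b V)" using finite_V by simp
    show "f ` F \<subseteq> Pow (insert b V)" using S by (auto simp: f_def)
    show "pairwise (\<lambda>A B. \<not> A \<subseteq> B) (f ` F)"
    proof (rule pairwiseI, rule notI)
      fix X Y assume "X \<in> f ` F" "Y \<in> f ` F" and neq': "X \<noteq> Y" and sub: "X \<subseteq> Y"
      then obtain A S B T where "(A, S) \<in> F" "X = f (A, S)" "(B, T) \<in> F" "Y = f (B, T)"
        by (metis imageE prod.collapse)
      then show False using anti[of A S B T] neq' sub by simp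
    qed
    show "ys @ b # zs \<in> permutations_of_set (insert b V)"
      using ys zs b N_subset[of b] by (auto simp: permutations_of_set_def)
    show "set (take k (ys @ b # zs)) \<notin> f ` F" for k
    proof
      assume "set (take k (ys @ b # zs)) \<in> f ` F"
      then obtain A S where AS: "(A, S) \<in> F" "set (take k (ys @ b # zs)) = A \<union> (S \<inter> {b})"
        by (auto simp: f_def)
      show False
      proof (cases "k \<le> length ys")
        case True
        then have "A \<union> (S \<inter> {b}) \<subseteq> N b"
          using AS(2) ys(1) set_take_subset[of k ys] by auto
        then show False
          using N_not_above[OF AS(1), of b] U b N_subset[of b] by auto
      next
        case False
        then have "N b \<union> {b} \<subseteq> A \<union> (S \<inter> {b})"
          using AS(2) ys(1) by (cases "k - length ys") auto
        then show False
          using N_not_below[OF AS(1), of b] S[OF AS(1)] b N_subset[of b] by blast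
      qed
    qed
  qed
  also have "card (insert b V) = card V + 1" using b finite_V by simp
  finally show ?thesis .
qed

lemma N_eq: "u \<in> U \<Longrightarrow> N u = {v \<in> V. u \<in> ty v}"
  using N_subset[of u] by (auto simp: ty_def)

lemma V_minus_N_eq: "u \<in> U \<Longrightarrow> V - N u = {v \<in> V. u \<notin> ty v}"
  by (auto simp: ty_def)

lemma N_eq_V: "card (N u) = card V \<Longrightarrow> N u = V"
  using card_subset_eq[OF finite_V N_subset] by simp

lemma N_eq_empty: "card (V - N u) = card V \<Longrightarrow> N u = {}"
  using card_subset_eq[of V "V - N u"] finite_V N_subset[of u] by blast

lemma card_F_less:
  assumes U: "U = {a, b, c}" and neq: "a \<noteq> b" "a \<noteq> c" "b \<noteq> c" and p: "5 \<le> card V"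
  shows "card F < midbinom (card V + 1)"
proof (cases "\<exists>i\<in>U. \<exists>j\<in>U. i \<noteq> j \<and> N i = V \<and> N j = {}")
  case True
  then obtain i j where ij: "i \<in> U" "j \<in> U" "i \<noteq> j" "N i = V" "N j = {}" by blast
  obtain k where k: "k \<in> U" "k \<noteq> i" "k \<noteq> j"
    using U neq by (metis insertCI)
  have "U = {i, k, j}"
    using ij(1-3) k by (intro card_seteq[symmetric]) (auto simp: U neq)
  then show ?thesis using card_F_less_if_full_and_empty[of i k j] ij k by blast
next
  case False
  have sum_U: "sum f (Pow U) = f {} + f {a} + f {b} + f {c} + f {a, b} + f {a, c} + f {b, c} + f {a, b, c}"
    for f :: "'a set \<Rightarrow> nat"
    using neq by (simp add: U sum_Pow_insert)
  \<comment> \<open>A capital letter belongs to the complement of the type of its small letter, so a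
    positive \<open>X\<close> empties the fiber of \<open>{a}\<close>, and a positive
    \<open>x\<close> that of \<open>{b, c}\<close>.\<close>
  define x where "x = card (cell {a})"
  define y where "y = card (cell {b})"
  define z where "z = card (cell {c})"
  define X where "X = card (cell {b, c})"
  define Y where "Y = card (cell {a, c})"
  define Z where "Z = card (cell {a, b})"
  define e where "e = card (cell {})"
  define t where "t = card (cell {a, b, c})"
  note cells = x_def y_def z_def X_def Y_def Z_def e_def t_def
  define num where "num P = (if P {} then e else 0) + (if P {a} then x else 0) +
      (if P {b} then y else 0) + (if P {c} then z else 0) + (if P {a, b} then Z else 0) +
      (if P {a, c} then Y else 0) + (if P {b, c} then X else 0) + (if P {a, b, c} then t else 0)" for P
  have count: "card {v \<in> V. P (ty v)} = num P" for P
    by (simp only: card_by_type sum_U cells num_def)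
  have cV: "x + y + z + X + Y + Z + e + t = card V"
    using count[of "\<lambda>_. True"] by (simp add: num_def)
  have cN: "card (N a) = x + Y + Z + t" "card (N b) = y + X + Z + t" "card (N c) = z + X + Y + t"
    using count[of "\<lambda>T. a \<in> T"] count[of "\<lambda>T. b \<in> T"] count[of "\<lambda>T. c \<in> T"] neq
    by (simp_all add: N_eq U num_def)
  have cC: "card (V - N a) = y + z + X + e" "card (V - N b) = x + z + Y + e"
      "card (V - N c) = x + y + Z + e"
    using count[of "\<lambda>T. a \<notin> T"] count[of "\<lambda>T. b \<notin> T"] count[of "\<lambda>T. c \<notin> T"] neq
    by (simp_all add: V_minus_N_eq U num_def)
  have diff: "U - {} = {a, b, c}" "U - {a} = {b, c}" "U - {b} = {a, c}" "U - {c} = {a, b}"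
    "U - {a, b} = {c}" "U - {a, c} = {b}" "U - {b, c} = {a}" "U - {a, b, c} = {}"
    using neq by (auto simp: U)
  have free': "card (fiber S) \<le> midbinom (num (\<lambda>T. T \<inter> S \<noteq> {} \<and> \<not> U - S \<subseteq> T))" for S
    using card_fiber_le by (simp flip: count)
  \<comment> \<open>For \<open>S = {}\<close> and \<open>S = U\<close> no cell is free, and
    \<open>midbinom 0 = 1\<close>.\<close>
  have free: "card (fiber {}) \<le> 1" "card (fiber {a}) \<le> midbinom (x + Y + Z)" "card (fiber {b}) \<le> midbinom (y + X + Z)"
      "card (fiber {c}) \<le> midbinom (z + X + Y)" "card (fiber {a, b}) \<le> midbinom (x + y + Z)"
      "card (fiber {a, c}) \<le> midbinom (x + z + Y)" "card (fiber {b, c}) \<le> midbinom (y + z + X)"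
      "card (fiber {a, b, c}) \<le> 1"
    using free'[of "{}"] free'[of "{a}"] free'[of "{b}"] free'[of "{c}"]
      free'[of "{a, b}"] free'[of "{a, c}"] free'[of "{b, c}"] free'[of "{a, b, c}"] neq neq[symmetric]
    unfolding num_def diff by (simp_all add: midbinom_def[of 0] ac_simps)
  have "card (cell (U - S)) > 0 \<longrightarrow> card (fiber S) = 0" if "S \<subseteq> U" for S
    using fiber_eq_empty_if_cell[OF that] by (cases "cell (U - S) = {}") simp_all
  from this[of "{}"] this[of "{a}"] this[of "{b}"] this[of "{c}"]
    this[of "{a, b}"] this[of "{a, c}"] this[of "{b, c}"] this[of "{a, b, c}"]
  have cell: "X > 0 \<longrightarrow> card (fiber {a}) = 0" "Y > 0 \<longrightarrow> card (fiber {b}) = 0"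
      "Z > 0 \<longrightarrow> card (fiber {c}) = 0" "x > 0 \<longrightarrow> card (fiber {b, c}) = 0"
      "y > 0 \<longrightarrow> card (fiber {a, c}) = 0" "z > 0 \<longrightarrow> card (fiber {a, b}) = 0"
      "t > 0 \<longrightarrow> card (fiber {}) = 0" "e > 0 \<longrightarrow> card (fiber {a, b, c}) = 0"
    unfolding diff cells[symmetric] by (simp_all add: U)
  have no: False if "i \<in> U" "j \<in> U" "i \<noteq> j" "card (N i) = card V" "card (V - N j) = card V" for i j
    using False N_eq_V N_eq_empty that by blast
  have mem: "a \<in> U" "b \<in> U" "c \<in> U" by (simp_all add: U)
  \<comment> \<open>If types \<open>{a}\<close> and \<open>{a, b}\<close> exhausted
    \<open>V\<close>, then \<open>N a = V\<close> and \<open>N c = {}\<close>, the case already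
    excluded. The next five facts treat the other ordered pairs.\<close>
  have ne1: "x + Z \<noteq> card V"
    by (rule notI, rule no[of a c]) (use mem neq cN cC cV in \<open>blast | linarith\<close>)+
  have ne2: "x + Y \<noteq> card V"
    by (rule notI, rule no[of a b]) (use mem neq cN cC cV in \<open>blast | linarith\<close>)+
  have ne3: "y + Z \<noteq> card V"
    by (rule notI, rule no[of b c]) (use mem neq cN cC cV in \<open>blast | linarith\<close>)+
  have ne4: "y + X \<noteq> card V"
    by (rule notI, rule no[of b a]) (use mem neq cN cC cV in \<open>blast | linarith\<close>)+
  have ne5: "z + X \<noteq> card V"
    by (rule notI, rule no[of c a]) (use mem neq cN cC cV in \<open>blast | linarith\<close>)+
  have ne6: "z + Y \<noteq> card V"
    by (rule notI, rule no[of c b]) (use mem neq cN cC cV in \<open>blast | linarith\<close>)+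
  have full: "card (fiber S) = 0" if "card (N u) = card V" "u \<in> U - S" for u S
    using fiber_eq_empty_if_full[OF N_eq_V] that by simp
  have empt: "card (fiber S) = 0" if "card (V - N u) = card V" "u \<in> S" for u S
    using fiber_eq_empty_if_empty[OF N_eq_empty] that by simp
  have single: "card (fiber S) \<le> midbinom (num (\<lambda>T. T \<inter> S \<noteq> {} \<and> \<not> U - S \<subseteq> T \<and> u \<notin> T))"
    if "card (N u) = 1" "u \<in> S" "u \<in> U" for u S
    using card_fiber_le_if_singleton[OF that] by (simp flip: count)
  have cosingle: "card (fiber S) \<le> midbinom (num (\<lambda>T. T \<inter> S \<noteq> {} \<and> \<not> U - S \<subseteq> T \<and> u \<in> T))"
    if "card (V - N u) = 1" "u \<in> U - S" for u S
    using card_fiber_le_if_co_singleton[OF that] by (simp flip: count)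
  have "card F = card (fiber {}) + card (fiber {a}) + card (fiber {b}) + card (fiber {c}) + card (fiber {a, b})
      + card (fiber {a, c}) + card (fiber {b, c}) + card (fiber {a, b, c})"
    by (simp only: card_F sum_U)
  also have "\<dots> < midbinom (card V + 1)"
  proof (rule profile_bound[OF p cV free cell ne1 ne2 ne3 ne4 ne5 ne6])
    show "x + Y + Z + t = card V \<longrightarrow> card (fiber {}) = 0 \<and> card (fiber {b}) = 0 \<and>
        card (fiber {c}) = 0 \<and> card (fiber {b, c}) = 0"
      "y + X + Z + t = card V \<longrightarrow> card (fiber {}) = 0 \<and> card (fiber {a}) = 0 \<and>
        card (fiber {c}) = 0 \<and> card (fiber {a, c}) = 0"
      "z + X + Y + t = card V \<longrightarrow> card (fiber {}) = 0 \<and> card (fiber {a}) = 0 \<and>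
        card (fiber {b}) = 0 \<and> card (fiber {a, b}) = 0"
      using full[of a] full[of b] full[of c] unfolding cN by (simp_all add: U neq neq[symmetric])
    show "y + z + X + e = card V \<longrightarrow> card (fiber {a}) = 0 \<and> card (fiber {a, b}) = 0 \<and>
        card (fiber {a, c}) = 0 \<and> card (fiber {a, b, c}) = 0"
      "x + z + Y + e = card V \<longrightarrow> card (fiber {b}) = 0 \<and> card (fiber {a, b}) = 0 \<and>
        card (fiber {b, c}) = 0 \<and> card (fiber {a, b, c}) = 0"
      "x + y + Z + e = card V \<longrightarrow> card (fiber {c}) = 0 \<and> card (fiber {a, c}) = 0 \<and>
        card (fiber {b, c}) = 0 \<and> card (fiber {a, b, c}) = 0"
      using empt[of a] empt[of b] empt[of c] unfolding cC by simp_all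
    \<comment> \<open>Of the free cells counted by \<open>x + y + Z\<close> for
      \<open>{a, b}\<close>, only \<open>y\<close> avoids \<open>a\<close>; likewise only
      \<open>z\<close> remains for \<open>{a, c}\<close>.\<close>
    show "x + Y + Z + t = 1 \<longrightarrow> card (fiber {a, b}) \<le> midbinom y \<and> card (fiber {a, c}) \<le> midbinom z"
      using single[of a "{a, b}"] single[of a "{a, c}"] neq neq[symmetric]
      unfolding num_def cN diff by (simp add: U)
    show "y + X + Z + t = 1 \<longrightarrow> card (fiber {a, b}) \<le> midbinom x \<and> card (fiber {b, c}) \<le> midbinom z"
      using single[of b "{a, b}"] single[of b "{b, c}"] neq neq[symmetric]
      unfolding num_def cN diff by (simp add: U)
    show "z + X + Y + t = 1 \<longrightarrow> card (fiber {a, c}) \<le> midbinom x \<and> card (fiber {b, c}) \<le> midbinom y"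
      using single[of c "{a, c}"] single[of c "{b, c}"] neq neq[symmetric]
      unfolding num_def cN diff by (simp add: U)
    \<comment> \<open>Here only free cells whose type contains \<open>a\<close> survive:
      \<open>Z\<close> for \<open>{b}\<close> and \<open>Y\<close> for \<open>{c}\<close>.\<close>
    show "y + z + X + e = 1 \<longrightarrow> card (fiber {b}) \<le> midbinom Z \<and> card (fiber {c}) \<le> midbinom Y"
      using cosingle[of a "{b}"] cosingle[of a "{c}"] neq neq[symmetric]
      unfolding num_def cC diff by simp
    show "x + z + Y + e = 1 \<longrightarrow> card (fiber {a}) \<le> midbinom Z \<and> card (fiber {c}) \<le> midbinom X"
      using cosingle[of b "{a}"] cosingle[of b "{c}"] neq neq[symmetric]
      unfolding num_def cC diff by simp
    show "x + y + Z + e = 1 \<longrightarrow> card (fiber {a}) \<le> midbinom Y \<and> card (fiber {b}) \<le> midbinom X"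
      using cosingle[of c "{a}"] cosingle[of c "{b}"] neq neq[symmetric]
      unfolding num_def cC diff by simp
  qed
  finally show ?thesis .
qed

end

section \<open>From diameter two to a neighborhood family\<close>

lemma two_step_if_digraph_diameter_le_2:
  assumes "wf_digraph D" "digraph_diameter D \<le> 2" "u \<in> verts D" "v \<in> verts D" "u \<noteq> v"
  shows "(u, v) \<in> arcs_ends D \<or> (\<exists>x. (u, x) \<in> arcs_ends D \<and> (x, v) \<in> arcs_ends D)"
proof -
  interpret wf_digraph D by fact
  have "digraph_dist D u v \<le> digraph_diameter D"
    unfolding digraph_diameter_def using assms(3,4) by (intro SUP_upper2[of "(u, v)"]) auto
  \<comment> \<open>A strict bound on the infimum yields an actual walk below it, without arguing
    that the infimum is attained; integrality of the length does the rest.\<close>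
  also have "\<dots> < 3" using assms(2) by (rule order.strict_trans1) simp
  finally have "(INF p\<in>{p. awalk u p v}. ereal (awalk_cost (\<lambda>_. 1) p)) < 3"
    by (simp add: digraph_dist_def \<mu>_def)
  then obtain p where p: "awalk u p v" "ereal (awalk_cost (\<lambda>_. 1) p) < 3"
    by (auto simp: INF_less_iff)
  have "awalk_cost (\<lambda>_. 1) p = real (length p)"
    by (simp add: awalk_cost_def sum_list_triv)
  then have "length p < 3" using p(2) by simp
  then consider "p = []" | e where "p = [e]" | e f where "p = [e, f]"
    by (cases p; cases "tl p"; cases "tl (tl p)") auto
  then show ?thesis
    proof cases
    case 1
    then show ?thesis using p(1) assms(5) by (simp add: awalk_simps)
  next
    case 2
    then show ?thesis using p(1) in_arcs_imp_in_arcs_ends[of e] by (auto simp: awalk_simps)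
  next
    case 3
    then show ?thesis
      using p(1) in_arcs_imp_in_arcs_ends[of e] in_arcs_imp_in_arcs_ends[of f] by (auto simp: awalk_simps)
  qed
qed

theorem theorem4p24:
  fixes G :: "('a, 'b) pre_digraph" and D :: "('a, 'c) pre_digraph" and p q :: nat
  assumes "5 \<le> p" and "p \<le> q"
    and "complete_tripartite_digraph 3 p q G"
    and "strong_orientation D G"
    and "digraph_diameter D = 2"
  shows "q \<le> ((p + 1) choose ((p + 1) div 2)) - 1"
proof -
  obtain U V W where parts: "verts G = U \<union> V \<union> W" "U \<inter> V = {}" "U \<inter> W = {}" "V \<inter> W = {}"
    and cards: "card U = 3" "card V = p" "card W = q"
    and ends: "arcs_ends G = U \<times> V \<union> V \<times> U \<union> U \<times> W \<union> W \<times> U \<union> V \<times> W \<union> W \<times> V"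
    using assms(3) unfolding complete_tripartite_digraph_def by blast
  define R where "R = arcs_ends D"
  have D: "digraph D" "verts D = U \<union> V \<union> W" and R: "R \<union> R\<inverse> = arcs_ends G" "R \<inter> R\<inverse> = {}"
    using assms(4) parts(1) by (auto simp: strong_orientation_def orientation_def R_def)
  have wf: "wf_digraph D"
    using D(1) by (simp add: digraph_def fin_digraph_def)
  have R_sub: "(i, j) \<in> arcs_ends G" if "(i, j) \<in> R" for i j
    using R(1) that by blast
  have asym: "(j, i) \<notin> R" if "(i, j) \<in> R" for i j
    using R(2) that by blast
  have R_total: "(i, j) \<in> R \<or> (j, i) \<in> R" if "(i, j) \<in> arcs_ends G" for i j
    using R(1) that by blast
  have two_step: "\<exists>x. (i, x) \<in> R \<and> (x, j) \<in> R" if "i \<in> U \<union> V \<union> W" "j \<in> U \<union> V \<union> W" "i \<noteq> j" "(i, j) \<notin> R" for i j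
    using two_step_if_digraph_diameter_le_2[OF wf _ _ _ that(3)] that assms(5) D(2) by (auto simp: R_def)
  \<comment> \<open>\<open>N\<close> is defined on all vertices, so it serves both for the sets
    \<open>N u\<close> and for the first component of \<open>nb w\<close>.\<close>
  define N where "N u = {v \<in> V. (u, v) \<in> R}" for u
  define nb where "nb w = (N w, {u \<in> U. (w, u) \<in> R})" for w
  have UW: "(w, u) \<in> R \<longleftrightarrow> (u, w) \<notin> R" if "u \<in> U" "w \<in> W" for u w
    using R_total[of u w] asym[of u w] that ends by blast
  have VW: "(w, v) \<in> R \<longleftrightarrow> (v, w) \<notin> R" if "v \<in> V" "w \<in> W" for v w
    using R_total[of v w] asym[of v w] that ends by blast
  have UV: "(v, u) \<in> R \<longleftrightarrow> (u, v) \<notin> R" if "v \<in> V" "u \<in> U" for u v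
    using R_total[of u v] asym[of u v] that ends by blast
  \<comment> \<open>The middle vertex is adjacent to both a vertex of \<open>U\<close> and one of
    \<open>W\<close>; parts carry no inner arcs, so it lies in \<open>V\<close>.\<close>
  have via_V: "\<exists>v\<in>V. (i, v) \<in> R \<and> (v, j) \<in> R" if ij: "i \<in> U \<and> j \<in> W \<or> i \<in> W \<and> j \<in> U" "(i, j) \<notin> R" for i j
  proof -
    obtain x where "(i, x) \<in> R" "(x, j) \<in> R" using two_step[of i j] ij parts(3) by blast
    then show ?thesis using R_sub[of i x] R_sub[of x j] ij(1) parts unfolding ends by blast
  qed
  have via_U: "\<exists>u\<in>U. (i, u) \<in> R \<and> (u, j) \<in> R" if ij: "i \<in> V \<and> j \<in> W \<or> i \<in> W \<and> j \<in> V" "(i, j) \<notin> R" for i j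
  proof -
    obtain x where "(i, x) \<in> R" "(x, j) \<in> R" using two_step[of i j] ij parts(4) by blast
    then show ?thesis using R_sub[of i x] R_sub[of x j] ij(1) parts unfolding ends by blast
  qed
  \<comment> \<open>The middle vertex of a path from \<open>w\<close> to \<open>w'\<close> is an
    out-neighbour of \<open>w\<close> but not of \<open>w'\<close>.\<close>
  have incomparable: "w = w'" if ww: "w \<in> W" "w' \<in> W" "fst (nb w) \<subseteq> fst (nb w')" "snd (nb w) \<subseteq> snd (nb w')" for w w'
  proof (rule ccontr)
    assume "w \<noteq> w'"
    moreover have "(w, w') \<notin> R" using R_sub[of w w'] ww(1,2) parts unfolding ends by blast
    ultimately obtain x where x: "(w, x) \<in> R" "(x, w') \<in> R" using two_step[of w w'] ww(1,2) by blast
    then have "x \<in> U \<union> V" using R_sub[of w x] ww(1) parts unfolding ends by blast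
    then have "(w', x) \<in> R" using x(1) ww(3,4) by (auto simp: nb_def N_def)
    then show False using asym x(2) by blast
  qed
  obtain a b c where abc: "U = {a, b, c}" "a \<noteq> b" "a \<noteq> c" "b \<noteq> c"
    using cards(1) by (auto simp: card_3_iff)
  have fin: "finite U" "finite V"
    using cards assms(1) by (auto intro: card_ge_0_finite)
  have N_not_below: "\<not> N u \<subseteq> N w" if uw: "w \<in> W" "u \<in> U" "(w, u) \<in> R" for u w
  proof -
    have "(u, w) \<notin> R" using UW uw by blast
    then obtain v where "v \<in> V" "(u, v) \<in> R" "(v, w) \<in> R" using via_V[of u w] uw by blast
    then have "v \<in> N u" "v \<notin> N w" using VW uw(1) by (simp_all add: N_def)
    then show ?thesis by blast
  qed
  have N_not_above: "\<not> N w \<subseteq> N u" if uw: "w \<in> W" "u \<in> U" "(w, u) \<notin> R" for u w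
  proof -
    obtain v where "v \<in> V" "(w, v) \<in> R" "(v, u) \<in> R" using via_V[of w u] uw by blast
    then have "v \<in> N w" "v \<notin> N u" using UV uw(2) by (simp_all add: N_def)
    then show ?thesis by blast
  qed
  have mem_witness: "\<exists>u\<in>U. (w, u) \<notin> R \<and> v \<notin> N u" if vw: "w \<in> W" "v \<in> N w" for v w
  proof -
    have v: "v \<in> V" "(v, w) \<notin> R" using VW vw by (auto simp: N_def)
    then obtain u where "u \<in> U" "(v, u) \<in> R" "(u, w) \<in> R" using via_U[of v w] vw(1) by blast
    then show ?thesis using UV[of v u] UW[of u w] v(1) vw(1) by (auto simp: N_def)
  qed
  have nonmem_witness: "\<exists>u\<in>U. (w, u) \<in> R \<and> v \<in> N u" if vw: "w \<in> W" "v \<in> V" "v \<notin> N w" for v w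
  proof -
    have "(w, v) \<notin> R" using vw by (auto simp: N_def)
    then obtain u where "u \<in> U" "(w, u) \<in> R" "(u, v) \<in> R" using via_U[of w v] vw by blast
    then show ?thesis using vw(2) by (auto simp: N_def)
  qed
  interpret neighborhood_family V U N "nb ` W"
  proof
    show "finite V" "finite U" "V \<inter> U = {}" "N u \<subseteq> V" for u
      using fin parts(2) by (auto simp: N_def)
    show "A \<subseteq> V \<and> S \<subseteq> U" if "(A, S) \<in> nb ` W" for A S
      using that by (auto simp: nb_def N_def)
    show "A = B \<and> S = T"
      if pairs: "(A, S) \<in> nb ` W" "(B, T) \<in> nb ` W" "A \<subseteq> B" "S \<subseteq> T" for A S B T
    proof -
      obtain w w' where w: "w \<in> W" "(A, S) = nb w" "w' \<in> W" "(B, T) = nb w'"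
        using pairs(1,2) by blast
      then have "w = w'" using incomparable[of w w'] pairs(3,4) by (metis fst_conv snd_conv)
      then show ?thesis using w(2,4) by (metis prod.inject)
    qed
    show "\<not> N u \<subseteq> A" if "(A, S) \<in> nb ` W" "u \<in> S" for A S u
      using that N_not_below[of _ u] unfolding nb_def by blast
    show "\<not> A \<subseteq> N u" if "(A, S) \<in> nb ` W" "u \<in> U - S" for A S u
      using that N_not_above[of _ u] unfolding nb_def by blast
    show "\<exists>u\<in>U - S. v \<notin> N u" if "(A, S) \<in> nb ` W" "v \<in> A" for A S v
      using that mem_witness[of _ v] unfolding nb_def by blast
    show "\<exists>u\<in>S. v \<in> N u" if "(A, S) \<in> nb ` W" "v \<in> V - A" for A S v
      using that nonmem_witness[of _ v] unfolding nb_def by blast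
  qed
  have "inj_on nb W" using incomparable by (intro inj_onI) simp
  then have "q = card (nb ` W)" using cards(3) by (simp add: card_image)
  also have "\<dots> < midbinom (p + 1)"
    using card_F_less[OF abc] assms(1) cards(2) by simp
  finally show ?thesis by (simp add: midbinom_def)
qed

end
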